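(* Let $p$ be a prime, and let $A$ and $C$ be two abelian groups of order $p^n$, with defining partitions $a$ and $c$ respectively. Then the following are equivalent: (a) $\mathrm{os}(A)$ dominates $\mathrm{os}(C)$; (b) $c'\succeq a'$; (c) $a\succeq c$.
   Context: For a finite group $G$ of order $N$, the order sequence $\mathrm{os}(G)$ is the list of orders of all elements of $G$ arranged in non-decreasing order. For groups $G,H$ of the same order $N$ with $\mathrm{os}(G)=(x_1,\dots,x_N)$ and $\mathrm{os}(H)=(y_1,\dots,y_N)$, $\mathrm{os}(G)$ dominates $\mathrm{os}(H)$ if $x_i\ge y_i$ for $1\le i\le N$. A partition of $n$ is a non-increasing sequence $(r_1,\dots,r_k)$ of positive integers with sum $n$. The defining partition of an abelian group $A$ of order $p^n$ is the unique partition $(r_1,\dots,r_k)$ of $n$ with $A\cong\mathbb{Z}_{p^{r_1}}\times\cdots\times\mathbb{Z}_{p^{r_k}}$. The conjugate of a partition $a=(r_1,\dots,r_k)$ is the partition $a'=(s_1,\dots,s_\ell)$ with $\ell=r_1$ and $s_i=|\{j:r_j\ge i\}|$. For partitions $a=(r_1,r_2,\dots)$ and $b=(s_1,s_2,\dots)$ of $n$, with zeros appended to the shorter one so that they have equal length, $a\succeq b$ means $r_1+\cdots+r_j\ge s_1+\cdots+s_j$ for all relevant $j$ (natural partial order, or majorization). *)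

theory Defs
  imports "HOL-Algebra.Algebra" "HOL-Library.Multiset"
begin

definition order_sequence :: "('a, 'm) monoid_scheme \<Rightarrow> nat list" where
  "order_sequence G = sorted_list_of_multiset (image_mset (group.ord G) (mset_set (carrier G)))"

(* list_all2 also demands equal lengths, i.e. groups of the same order. *)
definition os_dominates :: "('a, 'm) monoid_scheme \<Rightarrow> ('b, 'k) monoid_scheme \<Rightarrow> bool" where
  "os_dominates G H \<longleftrightarrow> list_all2 (\<lambda>x y. x \<ge> y) (order_sequence G) (order_sequence H)"

definition is_partition :: "nat \<Rightarrow> nat list \<Rightarrow> bool" where
  "is_partition n a \<longleftrightarrow> sorted_wrt (\<ge>) a \<and> (\<forall>r \<in> set a. 0 < r) \<and> sum_list a = n"

(* A relation, to be read "a is the defining partition of A"; it applies to abelian groups A of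
   order p^n, for which exactly one such a exists. *)
definition is_defining_partition ::
    "nat \<Rightarrow> nat \<Rightarrow> ('a, 'm) monoid_scheme \<Rightarrow> nat list \<Rightarrow> bool" where
  "is_defining_partition p n A a \<longleftrightarrow>
     is_partition n a \<and>
     A \<cong> product_group {..<length a} (\<lambda>i. integer_mod_group (p ^ (a ! i)))"

(* Parts are indexed from 0 and the values i range over 1, ..., r_1, where r_1 is read as 0 for
   the empty partition of 0. *)
definition conjugate_partition :: "nat list \<Rightarrow> nat list" where
  "conjugate_partition a =
     map (\<lambda>i. card {j. j < length a \<and> a ! j \<ge> i})
       [1..<Suc (case a of [] \<Rightarrow> 0 | r # _ \<Rightarrow> r)]"

(* take j returns the whole list once j exceeds its length, which has the same effect on the
   partial sums as appending zeros. *)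
definition majorizes :: "nat list \<Rightarrow> nat list \<Rightarrow> bool" where
  "majorizes a b \<longleftrightarrow> (\<forall>j. sum_list (take j a) \<ge> sum_list (take j b))"

end

theory Submission
  imports Defs
begin

text \<open>
  Each of the three relations between \<open>A\<close> and \<open>C\<close> says that
  \<open>\<Sum>\<^sub>j min a\<^sub>j i \<le> \<Sum>\<^sub>j min c\<^sub>j i\<close> for every \<open>i\<close>.

  For the order sequences: one sorted list lies above another of the same length exactly when, for
  every bound \<open>m\<close>, at most as many of its entries are \<open>\<le> m\<close>
  (\<open>list_all2_ge_iff_length_filter\<close>). In a group of order \<open>p ^ n\<close> all element orders are powers of
  \<open>p\<close>, so only the bounds \<open>m = p ^ i\<close> matter, and the elements of order at most \<open>p ^ i\<close> are those
  killed by \<open>p ^ i\<close>. A cyclic factor of order \<open>p ^ r\<close> has \<open>p ^ min r i\<close> of these, and the numbers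
  multiply over the factors, giving \<open>p\<close> to the power \<open>\<Sum>\<^sub>j min a\<^sub>j i\<close>
  (\<open>torsion_count_eq_power_sum_min\<close>).

  For the conjugates: the first \<open>i\<close> columns of the Young diagram of \<open>a\<close> contain
  \<open>\<Sum>\<^sub>j min a\<^sub>j i\<close> boxes (\<open>sum_list_take_conjugate_partition\<close>).

  For majorization of the partitions themselves: write \<open>T k\<close> for the sum of the first \<open>k\<close> parts of
  \<open>a\<close>, and \<open>E i = \<Sum>\<^sub>j (a\<^sub>j - i)\<close>, truncated at \<open>0\<close>, for the number of boxes beyond column \<open>i\<close>.
  These are Legendre transforms of each other: \<open>T k \<le> k * i + E i\<close> always, and for each \<open>k\<close> some
  \<open>i\<close>, and for each \<open>i\<close> some \<open>k\<close>, gives equality. Hence \<open>T k = min\<^sub>i (k * i + E i)\<close> and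
  \<open>E i = max\<^sub>k (T k - k * i)\<close>, so a pointwise inequality between the functions \<open>T\<close> of two partitions
  is equivalent to the same inequality between their functions \<open>E\<close>. Since
  \<open>E i = n - \<Sum>\<^sub>j min a\<^sub>j i\<close>, the inequality reverses when it is expressed by column sums
  (\<open>majorizes_iff_sum_min_le\<close>).
\<close>

section \<open>Dominance of sorted lists\<close>

text \<open>In a sorted list the entries \<open>\<le> m\<close> form an initial segment.\<close>

lemma sorted_nth_le_iff_less_length_filter:
  fixes m :: "'a :: linorder"
  assumes "sorted xs" "k < length xs"
  shows "xs ! k \<le> m \<longleftrightarrow> k < length (filter (\<lambda>x. x \<le> m) xs)"
  using assms
proof (induction xs arbitrary: k)
  case Nil
  then show ?case by simp
next
  case (Cons x xs)
  show ?case
  proof (cases "x \<le> m")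
    case True
    then show ?thesis using Cons by (cases k) auto
  next
    case False
    with Cons.prems(1) have gt: "\<forall>y \<in> set (x # xs). \<not> y \<le> m"
      by auto
    then have "filter (\<lambda>x. x \<le> m) (x # xs) = []"
      by (simp only: filter_empty_conv)
    moreover have "\<not> (x # xs) ! k \<le> m"
      using gt Cons.prems(2) nth_mem by blast
    ultimately show ?thesis by simp
  qed
qed

text \<open>
  Pointwise comparison of sorted lists is comparison of their distribution functions. In one
  direction, every entry \<open>\<le> m\<close> of \<open>xs\<close> sits above an entry \<open>\<le> m\<close> of \<open>ys\<close>. In the other, the
  entries at position \<open>k\<close> are compared through the bound \<open>m = xs ! k\<close>.
\<close>

lemma list_all2_ge_iff_length_filter:
  fixes xs ys :: "'a :: linorder list"
  assumes "sorted xs" "sorted ys" "length xs = length ys"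
  shows "list_all2 (\<lambda>x y. x \<ge> y) xs ys \<longleftrightarrow>
    (\<forall>m. length (filter (\<lambda>x. x \<le> m) xs) \<le> length (filter (\<lambda>y. y \<le> m) ys))"
proof
  assume "list_all2 (\<lambda>x y. x \<ge> y) xs ys"
  then show "\<forall>m. length (filter (\<lambda>x. x \<le> m) xs) \<le> length (filter (\<lambda>y. y \<le> m) ys)"
    by (induction rule: list_all2_induct) (auto intro: le_SucI)
next
  assume le: "\<forall>m. length (filter (\<lambda>x. x \<le> m) xs) \<le> length (filter (\<lambda>y. y \<le> m) ys)"
  have "ys ! k \<le> xs ! k" if k: "k < length xs" for k
  proof -
    have "k < length (filter (\<lambda>x. x \<le> xs ! k) xs)"
      using sorted_nth_le_iff_less_length_filter[OF assms(1) k] by blast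
    also have "\<dots> \<le> length (filter (\<lambda>y. y \<le> xs ! k) ys)"
      using le by blast
    finally show ?thesis
      using sorted_nth_le_iff_less_length_filter[OF assms(2)] assms(3) k by simp
  qed
  then show "list_all2 (\<lambda>x y. x \<ge> y) xs ys"
    using assms(3) by (simp add: list_all2_conv_all_nth)
qed

section \<open>Dominance of order sequences and counts of torsion elements\<close>

lemma length_filter_order_sequence:
  assumes "finite (carrier G)"
  shows "length (filter P (order_sequence G)) = card {x \<in> carrier G. P (group.ord G x)}"
proof -
  have "length (filter P (order_sequence G))
      = size (filter_mset P (image_mset (group.ord G) (mset_set (carrier G))))"
    unfolding order_sequence_def by (metis mset_filter mset_sorted_list_of_multiset size_mset)
  then show ?thesis
    using assms by (simp add: filter_mset_image_mset)
qed

definition torsion_count :: "('a, 'm) monoid_scheme \<Rightarrow> nat \<Rightarrow> nat" where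
  "torsion_count G k = card {x \<in> carrier G. x [^]\<^bsub>G\<^esub> k = \<one>\<^bsub>G\<^esub>}"

text \<open>
  By Lagrange an element order is some \<open>p ^ t\<close>, and for powers of \<open>p\<close> being at most \<open>m\<close>, being at
  most \<open>p ^ i\<close> and dividing \<open>p ^ i\<close> are the same condition.
\<close>

lemma card_ord_le_eq_torsion_count:
  assumes "group G" "Factorial_Ring.prime p" "order G = p ^ n" "p ^ i \<le> m" "m < p ^ Suc i"
  shows "card {x \<in> carrier G. group.ord G x \<le> m} = torsion_count G (p ^ i)"
proof -
  interpret group G by fact
  have p: "p > 1" using assms(2) prime_gt_1_nat by simp
  have "ord x \<le> m \<longleftrightarrow> x [^]\<^bsub>G\<^esub> (p ^ i) = \<one>\<^bsub>G\<^esub>" if x: "x \<in> carrier G" for x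
  proof -
    have "ord x dvd p ^ n"
      using ord_dvd_group_order[OF x] assms(3) by simp
    then obtain t where t: "ord x = p ^ t"
      using divides_primepow_nat[OF assms(2)] by blast
    have "ord x \<le> m \<longleftrightarrow> t \<le> i"
    proof
      assume "ord x \<le> m"
      then have "p ^ t < p ^ Suc i" using t assms(5) by linarith
      then show "t \<le> i" using p power_less_imp_less_exp less_Suc_eq_le by blast
    next
      assume "t \<le> i"
      then have "p ^ t \<le> p ^ i" using p by (intro power_increasing) auto
      then show "ord x \<le> m" using t assms(4) by simp
    qed
    also have "\<dots> \<longleftrightarrow> ord x dvd p ^ i"
      using t p dvd_power_iff_le[of p t i] by simp
    also have "\<dots> \<longleftrightarrow> x [^]\<^bsub>G\<^esub> (p ^ i) = \<one>\<^bsub>G\<^esub>"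
      using pow_eq_id[OF x] by simp
    finally show ?thesis .
  qed
  then show ?thesis
    unfolding torsion_count_def by (intro arg_cong[where f = card]) blast
qed

text \<open>
  Every bound \<open>m > 0\<close> lies in exactly one interval from \<open>p ^ i\<close> to \<open>p ^ (i + 1)\<close>, and there the
  number of elements of order at most \<open>m\<close> is constant.
\<close>

lemma os_dominates_iff_torsion_count_le:
  assumes p: "Factorial_Ring.prime p"
    and G: "group G" "order G = p ^ n" and H: "group H" "order H = p ^ n"
  shows "os_dominates G H \<longleftrightarrow> (\<forall>i. torsion_count G (p ^ i) \<le> torsion_count H (p ^ i))"
proof -
  have p1: "p > 1" using p prime_gt_1_nat by simp
  have fin: "finite (carrier G)" "finite (carrier H)"
    using G H p1 by (metis card.infinite order_def power_eq_0_iff not_one_less_zero)+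
  have len: "length (order_sequence G) = length (order_sequence H)"
    using length_filter_order_sequence[OF fin(1), of "\<lambda>_. True"]
      length_filter_order_sequence[OF fin(2), of "\<lambda>_. True"] G H by (simp add: order_def)
  have "os_dominates G H \<longleftrightarrow>
      (\<forall>m. card {x \<in> carrier G. group.ord G x \<le> m} \<le> card {x \<in> carrier H. group.ord H x \<le> m})"
    unfolding os_dominates_def
    using list_all2_ge_iff_length_filter[OF _ _ len]
    by (simp add: length_filter_order_sequence fin) (simp add: order_sequence_def)
  also have "\<dots> \<longleftrightarrow> (\<forall>i. torsion_count G (p ^ i) \<le> torsion_count H (p ^ i))"
  proof (intro iffI allI)
    fix i
    assume le: "\<forall>m. card {x \<in> carrier G. group.ord G x \<le> m} \<le> card {x \<in> carrier H. group.ord H x \<le> m}"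
    have "p ^ i < p ^ Suc i" using p1 by simp
    then show "torsion_count G (p ^ i) \<le> torsion_count H (p ^ i)"
      using le[rule_format, of "p ^ i"] card_ord_le_eq_torsion_count[OF G(1) p G(2) order_refl]
        card_ord_le_eq_torsion_count[OF H(1) p H(2) order_refl] by simp
  next
    fix m
    assume le: "\<forall>i. torsion_count G (p ^ i) \<le> torsion_count H (p ^ i)"
    show "card {x \<in> carrier G. group.ord G x \<le> m} \<le> card {x \<in> carrier H. group.ord H x \<le> m}"
    proof (cases "m = 0")
      case True
      have "{x \<in> carrier G. group.ord G x \<le> m} = {}"
        using group.ord_ge_1[OF G(1) fin(1)] True by fastforce
      then show ?thesis by (simp only: card.empty zero_le)
    next
      case False
      then obtain i where "p ^ i \<le> m" "m < p ^ Suc i"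
        using ex_power_ivl1[of p m] p1 by auto
      then show ?thesis
        using le card_ord_le_eq_torsion_count[OF G(1) p G(2)]
          card_ord_le_eq_torsion_count[OF H(1) p H(2)] by simp
    qed
  qed
  finally show ?thesis .
qed

section \<open>Counting torsion elements from the defining partition\<close>

lemma torsion_count_iso:
  assumes "group G" "group H" "G \<cong> H"
  shows "torsion_count G k = torsion_count H k"
proof -
  interpret G: group G by fact
  interpret H: group H by fact
  obtain h where h: "h \<in> hom G H" and bij: "bij_betw h (carrier G) (carrier H)"
    using assms(3) unfolding is_iso_def iso_def by blast
  interpret group_hom G H h
    using h by unfold_locales
  have inj: "inj_on h (carrier G)" and im: "h ` carrier G = carrier H"
    using bij by (auto simp: bij_betw_def)
  have eq: "h x [^]\<^bsub>H\<^esub> k = \<one>\<^bsub>H\<^esub> \<longleftrightarrow> x [^]\<^bsub>G\<^esub> k = \<one>\<^bsub>G\<^esub>" if x: "x \<in> carrier G" for x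
    using inj_on_eq_iff[OF inj G.nat_pow_closed[OF x] G.one_closed]
    by (simp only: hom_nat_pow[OF x] hom_one)
  let ?T = "{x \<in> carrier G. x [^]\<^bsub>G\<^esub> k = \<one>\<^bsub>G\<^esub>}"
  have "y \<in> h ` ?T \<longleftrightarrow> y \<in> carrier H \<and> y [^]\<^bsub>H\<^esub> k = \<one>\<^bsub>H\<^esub>" for y
  proof
    assume "y \<in> h ` ?T"
    then obtain x where x: "x \<in> carrier G" "x [^]\<^bsub>G\<^esub> k = \<one>\<^bsub>G\<^esub>" and y: "y = h x"
      by (elim imageE CollectE conjE)
    show "y \<in> carrier H \<and> y [^]\<^bsub>H\<^esub> k = \<one>\<^bsub>H\<^esub>"
      using x eq[OF x(1)] unfolding y by simp
  next
    assume y: "y \<in> carrier H \<and> y [^]\<^bsub>H\<^esub> k = \<one>\<^bsub>H\<^esub>"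
    then obtain x where x: "x \<in> carrier G" "y = h x"
      unfolding im[symmetric] by (elim conjE imageE)
    then have "x \<in> ?T" using y eq[OF x(1)] by simp
    then show "y \<in> h ` ?T" unfolding x(2) by (rule imageI)
  qed
  then have "h ` ?T = {y \<in> carrier H. y [^]\<^bsub>H\<^esub> k = \<one>\<^bsub>H\<^esub>}"
    by (simp only: set_eq_iff mem_Collect_eq simp_thms)
  moreover have "card (h ` ?T) = card ?T"
    by (rule card_image, rule inj_on_subset[OF inj]) simp
  ultimately show ?thesis
    unfolding torsion_count_def by simp
qed

lemma pow_product_group:
  "x [^]\<^bsub>product_group I G\<^esub> (k :: nat) = (\<lambda>i\<in>I. x i [^]\<^bsub>G i\<^esub> k)"
  by (induction k) (auto simp: fun_eq_iff)

lemma torsion_count_product_group: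
  assumes "finite I"
  shows "torsion_count (product_group I G) k = (\<Prod>i\<in>I. torsion_count (G i) k)"
proof -
  have "x [^]\<^bsub>product_group I G\<^esub> k = \<one>\<^bsub>product_group I G\<^esub>
      \<longleftrightarrow> (\<forall>i\<in>I. x i [^]\<^bsub>G i\<^esub> k = \<one>\<^bsub>G i\<^esub>)" for x
    unfolding pow_product_group one_product_group restrict_def fun_eq_iff by auto
  then have "{x \<in> carrier (product_group I G). x [^]\<^bsub>product_group I G\<^esub> k = \<one>\<^bsub>product_group I G\<^esub>}
      = (\<Pi>\<^sub>E i\<in>I. {x \<in> carrier (G i). x [^]\<^bsub>G i\<^esub> k = \<one>\<^bsub>G i\<^esub>})"
    by (auto simp: PiE_iff extensional_def)
  then show ?thesis
    unfolding torsion_count_def by (simp add: card_PiE assms)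
qed

lemma multiples_below_eq_image:
  fixes q m :: int
  assumes "q > 0"
  shows "{x \<in> {0..<m * q}. q dvd x} = (\<lambda>y. q * y) ` {0..<m}"
  using assms by (auto simp: dvd_def zero_le_mult_iff mult.commute)

text \<open>
  If \<open>r \<le> i\<close> the whole group is killed by \<open>p ^ i\<close>; otherwise the elements killed are the multiples
  of \<open>p ^ (r - i)\<close>, of which there are \<open>p ^ i\<close> below \<open>p ^ r\<close>.
\<close>

lemma torsion_count_integer_mod_group:
  assumes p: "p > 0"
  shows "torsion_count (integer_mod_group (p ^ r)) (p ^ i) = p ^ min r i"
proof (cases "r \<le> i")
  case True
  have "int (p ^ i) * x mod int (p ^ r) = 0" for x
    using True by (simp add: le_imp_power_dvd)
  then have "torsion_count (integer_mod_group (p ^ r)) (p ^ i) = card {0..<int (p ^ r)}"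
    using p unfolding torsion_count_def
    by (simp add: carrier_integer_mod_group atLeastLessThan_def atLeast_def lessThan_def Collect_conj_eq)
  also have "\<dots> = p ^ r"
    by (simp only: card_atLeastLessThan_int diff_zero nat_int)
  finally show ?thesis using True by (simp add: min_def)
next
  case False
  then have split: "int (p ^ r) = int (p ^ i) * int (p ^ (r - i))"
    by (simp flip: power_add)
  let ?q = "int (p ^ (r - i))"
  have q: "?q > 0" using p by simp
  have "int (p ^ i) * x mod int (p ^ r) = 0 \<longleftrightarrow> ?q dvd x" for x
    unfolding split using p by (simp add: mod_eq_0_iff_dvd)
  then have "{x \<in> carrier (integer_mod_group (p ^ r)).
        x [^]\<^bsub>integer_mod_group (p ^ r)\<^esub> (p ^ i) = \<one>\<^bsub>integer_mod_group (p ^ r)\<^esub>}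
      = {x \<in> {0..<int (p ^ r)}. ?q dvd x}"
    using p by (simp add: carrier_integer_mod_group)
  also have "\<dots> = (\<lambda>y. ?q * y) ` {0..<int (p ^ i)}"
    unfolding split by (rule multiples_below_eq_image[OF q])
  finally have "torsion_count (integer_mod_group (p ^ r)) (p ^ i)
      = card ((\<lambda>y. ?q * y) ` {0..<int (p ^ i)})"
    unfolding torsion_count_def by simp
  also have "\<dots> = card {0..<int (p ^ i)}"
    using p by (intro card_image) (simp add: inj_on_def)
  also have "\<dots> = p ^ i"
    by (simp only: card_atLeastLessThan_int diff_zero nat_int)
  finally show ?thesis using False by (simp add: min_def)
qed

lemma torsion_count_eq_power_sum_min:
  assumes "p > 0" "group G" "is_defining_partition p n G a"
  shows "torsion_count G (p ^ i) = p ^ (\<Sum>r\<leftarrow>a. min r i)"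
proof -
  have "torsion_count G (p ^ i)
      = torsion_count (product_group {..<length a} (\<lambda>j. integer_mod_group (p ^ (a ! j)))) (p ^ i)"
    using assms by (intro torsion_count_iso) (auto simp: is_defining_partition_def)
  also have "\<dots> = (\<Prod>j<length a. p ^ min (a ! j) i)"
    by (simp add: torsion_count_product_group torsion_count_integer_mod_group assms)
  also have "\<dots> = p ^ (\<Sum>r\<leftarrow>a. min r i)"
    by (simp add: power_sum sum_list_sum_nth atLeast0LessThan)
  finally show ?thesis .
qed

section \<open>Conjugation reverses majorization\<close>

text \<open>
  Both sides count the boxes in the first \<open>i\<close> columns of the Young diagram of \<open>a\<close>: by columns on the
  left, by rows on the right. The conjugate has as many parts as the largest part of \<open>a\<close>, called
  \<open>h\<close> below; later columns are empty.
\<close>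

lemma sum_list_take_conjugate_partition:
  assumes "sorted_wrt (\<ge>) a"
  shows "sum_list (take i (conjugate_partition a)) = (\<Sum>r\<leftarrow>a. min r i)"
proof -
  define h where "h = (case a of [] \<Rightarrow> 0 | r # _ \<Rightarrow> r)"
  have h: "a ! j \<le> h" if "j < length a" for j
    using assms that unfolding h_def by (cases a; cases j) auto
  have "sum_list (take i (conjugate_partition a))
      = (\<Sum>t\<leftarrow>[1..<Suc (min i h)]. card {j. j < length a \<and> a ! j \<ge> t})"
    unfolding conjugate_partition_def h_def[symmetric] take_map
    by (cases "i \<le> h") (simp_all add: min_def take_upt del: upt_Suc)
  also have "\<dots> = (\<Sum>t\<in>{1..min i h}. card {j. j < length a \<and> a ! j \<ge> t})"
    by (simp add: interv_sum_list_conv_sum_set_nat atLeastLessThanSuc_atLeastAtMost del: upt_Suc)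
  also have "\<dots> = (\<Sum>t\<in>{1..min i h}. \<Sum>j<length a. if a ! j \<ge> t then 1 else 0)"
    by (intro sum.cong) (simp_all add: sum.If_cases Int_def lessThan_def)
  also have "\<dots> = (\<Sum>j<length a. \<Sum>t\<in>{1..min i h}. if a ! j \<ge> t then 1 else 0)"
    by (rule sum.swap)
  also have "\<dots> = (\<Sum>j<length a. min (a ! j) i)"
  proof (rule sum.cong)
    fix j assume "j \<in> {..<length a}"
    then have "{1..min i h} \<inter> {t. t \<le> a ! j} = {1..min (a ! j) i}"
      using h[of j] by auto
    then show "(\<Sum>t\<in>{1..min i h}. if a ! j \<ge> t then 1 else 0) = min (a ! j) i"
      by (simp add: sum.If_cases)
  qed simp
  also have "\<dots> = (\<Sum>r\<leftarrow>a. min r i)"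
    by (simp add: sum_list_sum_nth atLeast0LessThan)
  finally show ?thesis .
qed

lemma sum_min_plus_sum_diff:
  fixes a :: "nat list"
  shows "(\<Sum>r\<leftarrow>a. min r i) + (\<Sum>r\<leftarrow>a. r - i) = sum_list a"
  by (induction a) auto

text \<open>
  The boxes of the first \<open>k\<close> rows lie in the rectangle of \<open>k\<close> rows and \<open>i\<close> columns or beyond
  column \<open>i\<close>.
\<close>

lemma sum_list_take_le_sum_diff:
  fixes a :: "nat list"
  shows "sum_list (take k a) \<le> k * i + (\<Sum>r\<leftarrow>a. r - i)"
proof (induction a arbitrary: k)
  case Nil
  then show ?case by simp
next
  case (Cons r a)
  show ?case
  proof (cases k)
    case (Suc l)
    then show ?thesis using Cons[of l] by simp
  qed simp
qed

text \<open>
  The previous bound is attained when the rectangle is filled and no row below it extends beyond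
  column \<open>i\<close>, that is, when its corner lies on the boundary of the Young diagram.
\<close>

lemma sum_list_take_eq_sum_diff:
  fixes a :: "nat list"
  assumes "k \<le> length a" "\<forall>r \<in> set (take k a). i \<le> r" "\<forall>r \<in> set (drop k a). r \<le> i"
  shows "sum_list (take k a) = k * i + (\<Sum>r\<leftarrow>a. r - i)"
proof -
  have "\<forall>r \<in> set b. i \<le> r \<Longrightarrow> sum_list b = length b * i + (\<Sum>r\<leftarrow>b. r - i)" for b :: "nat list"
    by (induction b) auto
  from this[OF assms(2)] have "sum_list (take k a) = k * i + (\<Sum>r\<leftarrow>take k a. r - i)"
    using assms(1) by simp
  moreover have "(\<Sum>r\<leftarrow>drop k a. r - i) = 0"
    using assms(3) by (simp add: sum_list_eq_0_iff)
  moreover have "(\<Sum>r\<leftarrow>a. r - i) = (\<Sum>r\<leftarrow>take k a. r - i) + (\<Sum>r\<leftarrow>drop k a. r - i)"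
    by (metis append_take_drop_id map_append sum_list_append)
  ultimately show ?thesis by simp
qed

text \<open>
  The boundary of the diagram of a partition has a point in every row and in every column. For row
  \<open>k\<close> take \<open>i = a ! k\<close>, the first part left out (or \<open>0\<close> if none is left); for column \<open>i\<close> take as
  \<open>k\<close> the number of parts that are at least \<open>i\<close>.
\<close>

lemma ex_sum_list_take_eq_sum_diff_level:
  fixes a :: "nat list"
  assumes "sorted_wrt (\<ge>) a"
  shows "\<exists>i. sum_list (take k a) = k * i + (\<Sum>r\<leftarrow>a. r - i)"
proof (cases "k < length a")
  case True
  have "\<forall>r \<in> set (take k a). a ! k \<le> r" "\<forall>r \<in> set (drop k a). r \<le> a ! k"
  proof -
    have "a = take k a @ a ! k # drop (Suc k) a"
      using True by (simp add: id_take_nth_drop)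
    then have "sorted_wrt (\<ge>) (take k a @ a ! k # drop (Suc k) a)"
      using assms by simp
    then show "\<forall>r \<in> set (take k a). a ! k \<le> r" "\<forall>r \<in> set (drop k a). r \<le> a ! k"
      using True by (auto simp: sorted_wrt_append Cons_nth_drop_Suc[symmetric])
  qed
  then show ?thesis
    using sum_list_take_eq_sum_diff[of k a "a ! k"] True by auto
next
  case False
  then have "sum_list (take k a) = k * 0 + (\<Sum>r\<leftarrow>a. r - 0)" by simp
  then show ?thesis by blast
qed

lemma ex_sum_list_take_eq_sum_diff_length:
  fixes a :: "nat list"
  assumes "sorted_wrt (\<ge>) a"
  shows "\<exists>k. sum_list (take k a) = k * i + (\<Sum>r\<leftarrow>a. r - i)"
proof -
  let ?k = "length (takeWhile (\<lambda>r. i \<le> r) a)"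
  have "\<forall>r \<in> set (dropWhile (\<lambda>r. i \<le> r) a). r \<le> i"
    using assms by (induction a) (auto intro: order_trans)
  moreover have "take ?k a = takeWhile (\<lambda>r. i \<le> r) a" "drop ?k a = dropWhile (\<lambda>r. i \<le> r) a"
    by (simp_all add: takeWhile_eq_take[symmetric] dropWhile_eq_drop[symmetric])
  ultimately have "sum_list (take ?k a) = ?k * i + (\<Sum>r\<leftarrow>a. r - i)"
    by (intro sum_list_take_eq_sum_diff) (auto simp: length_takeWhile_le dest: set_takeWhileD)
  then show ?thesis by blast
qed

text \<open>
  Each direction compares the two sides of the duality at a point where it is an equality for one
  partition, using for the other partition only the inequality.
\<close>

lemma majorizes_iff_sum_min_le:
  assumes a: "sorted_wrt (\<ge>) a" and c: "sorted_wrt (\<ge>) c" and eq: "sum_list a = sum_list c"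
  shows "majorizes a c \<longleftrightarrow> (\<forall>i. (\<Sum>r\<leftarrow>a. min r i) \<le> (\<Sum>r\<leftarrow>c. min r i))"
proof -
  have "majorizes a c \<longleftrightarrow> (\<forall>i. (\<Sum>r\<leftarrow>c. r - i) \<le> (\<Sum>r\<leftarrow>a. r - i))"
  proof (intro iffI allI)
    fix i assume maj: "majorizes a c"
    obtain k where "sum_list (take k c) = k * i + (\<Sum>r\<leftarrow>c. r - i)"
      using ex_sum_list_take_eq_sum_diff_length[OF c] by blast
    moreover have "sum_list (take k c) \<le> sum_list (take k a)"
      using maj by (simp add: majorizes_def)
    ultimately show "(\<Sum>r\<leftarrow>c. r - i) \<le> (\<Sum>r\<leftarrow>a. r - i)"
      using sum_list_take_le_sum_diff[of k a i] by linarith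
  next
    assume le: "\<forall>i. (\<Sum>r\<leftarrow>c. r - i) \<le> (\<Sum>r\<leftarrow>a. r - i)"
    show "majorizes a c"
      unfolding majorizes_def
    proof
      fix k
      obtain i where "sum_list (take k a) = k * i + (\<Sum>r\<leftarrow>a. r - i)"
        using ex_sum_list_take_eq_sum_diff_level[OF a] by blast
      then show "sum_list (take k c) \<le> sum_list (take k a)"
        using sum_list_take_le_sum_diff[of k c i] le by (metis add_left_mono order_trans)
    qed
  qed
  also have "\<dots> \<longleftrightarrow> (\<forall>i. (\<Sum>r\<leftarrow>a. min r i) \<le> (\<Sum>r\<leftarrow>c. min r i))"
  proof -
    have "(\<Sum>r\<leftarrow>c. r - i) \<le> (\<Sum>r\<leftarrow>a. r - i) \<longleftrightarrow> (\<Sum>r\<leftarrow>a. min r i) \<le> (\<Sum>r\<leftarrow>c. min r i)" for i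
      using sum_min_plus_sum_diff[of i a] sum_min_plus_sum_diff[of i c] eq by linarith
    then show ?thesis by simp
  qed
  finally show ?thesis .
qed

section \<open>The three orders coincide\<close>

theorem theorem3p4:
  fixes A :: "('a, 'm) monoid_scheme" and C :: "('b, 'k) monoid_scheme"
    and p n :: nat and a c :: "nat list"
  assumes "Factorial_Ring.prime p"
    and "comm_group A" and "order A = p ^ n"
    and "comm_group C" and "order C = p ^ n"
    and "is_defining_partition p n A a"
    and "is_defining_partition p n C c"
  shows "(os_dominates A C \<longleftrightarrow> majorizes (conjugate_partition c) (conjugate_partition a))
       \<and> (majorizes (conjugate_partition c) (conjugate_partition a) \<longleftrightarrow> majorizes a c)"
proof -
  have p: "p > 1" using assms(1) prime_gt_1_nat by simp
  then have p0: "p > 0" by simp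
  have groups: "group A" "group C"
    using assms(2,4) by (simp_all add: comm_group.axioms(2))
  have sorted: "sorted_wrt (\<ge>) a" "sorted_wrt (\<ge>) c" and total: "sum_list a = sum_list c"
    using assms(6,7) by (simp_all add: is_defining_partition_def is_partition_def)
  let ?min_sums_le = "\<forall>i. (\<Sum>r\<leftarrow>a. min r i) \<le> (\<Sum>r\<leftarrow>c. min r i)"
  have "os_dominates A C \<longleftrightarrow> ?min_sums_le"
    unfolding os_dominates_iff_torsion_count_le[OF assms(1) groups(1) assms(3) groups(2) assms(5)]
      torsion_count_eq_power_sum_min[OF p0 groups(1) assms(6)]
      torsion_count_eq_power_sum_min[OF p0 groups(2) assms(7)]
      power_increasing_iff[OF p] ..
  moreover have "majorizes (conjugate_partition c) (conjugate_partition a) \<longleftrightarrow> ?min_sums_le"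
    by (simp add: majorizes_def sum_list_take_conjugate_partition sorted)
  moreover have "majorizes a c \<longleftrightarrow> ?min_sums_le"
    by (rule majorizes_iff_sum_min_le[OF sorted total])
  ultimately show ?thesis by blast
qed

end
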